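(* Let $V$ be a set of outer commutator words and $\mathcal{V}$ the variety of groups it defines. Let $G,\bar G$ be groups with free presentations $1\to R\to F\xrightarrow{\pi} G\to 1$ and $1\to \bar R\to \bar F\xrightarrow{\bar\pi}\bar G\to 1$ respectively, and let $\alpha:G\to\bar G$ be a homomorphism. Then: (i) there exists a homomorphism $\beta:F\to\bar F$ such that $\alpha\pi=\bar\pi\beta$; (ii) there exists a homomorphism $\alpha^*:\mathcal{V}\tilde{\mathcal{B}}_0(G)\to\mathcal{V}\tilde{\mathcal{B}}_0(\bar G)$ which depends only on $\alpha$; namely, for $\beta$ as in (i), the rule $x\langle T(F)\cap R\rangle\mapsto\beta(x)\langle T(\bar F)\cap\bar R\rangle$ ($x\in R\cap V(F)$) is a well-defined homomorphism $\alpha^*$, and it is the same for every choice of $\beta$ satisfying (i); (iii) if $1\to\hat R\to\hat F\to\hat G\to 1$ is a free presentation of a group $\hat G$ and $\gamma:\bar G\to\hat G$ is a homomorphism, then $(\gamma\alpha)^*=\gamma^*\alpha^*$; (iv) $\mathcal{V}\tilde{\mathcal{B}}_0(G)$ is, up to isomorphism, independent of the free presentation of $G$ used to define it.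
   Context: Commutators: $[x,y]=x^{-1}y^{-1}xy$. Let $F_\infty$ be the free group on $x_1,x_2,\dots$. Outer commutator (o.c.) words are defined inductively: a variable $x_i$ is an o.c. word of weight one; if $u$ and $w$ are o.c. words of weights $s$ and $t$ in disjoint sets of variables, then $[u(x_1,\dots,x_s),w(x_{s+1},\dots,x_{s+t})]$ is an o.c. word of weight $s+t$. For a set $V$ of words and a group $G$, $T(G)=\{v(g_1,\dots,g_s)\mid v\in V,\ g_i\in G\}$ is the set of all values of words of $V$ in $G$, and $V(G)=\langle T(G)\rangle$ is the verbal subgroup. For a free presentation $1\to R\to F\to G\to 1$ ($F$ a free group, $R$ the kernel), the $\tilde{\mathcal{B}}_0$-invariant of $G$ with respect to $\mathcal{V}$, computed from this presentation, is $$\mathcal{V}\tilde{\mathcal{B}}_0(G)=\frac{R\cap V(F)}{\langle T(F)\cap R\rangle},$$ where $\langle T(F)\cap R\rangle$ is the subgroup generated by $T(F)\cap R$. In the claim, $\mathcal{V}\tilde{\mathcal{B}}_0$ of each group is computed from the given presentation of that group. *)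

theory Defs
  imports "HOL-Algebra.Generated_Groups"
begin

section \<open>Free groups\<close>

text \<open>The letter \<open>(x, True)\<close> is the generator \<open>x\<close>, and \<open>(x, False)\<close> is its formal inverse.\<close>

type_synonym 'x free_word = "('x \<times> bool) list"

definition letter_inv :: "'x \<times> bool \<Rightarrow> 'x \<times> bool" where
  "letter_inv a = (fst a, \<not> snd a)"

definition reduced :: "'x free_word \<Rightarrow> bool" where
  "reduced = successively (\<lambda>a b. b \<noteq> letter_inv a)"

fun cancel_cons :: "'x \<times> bool \<Rightarrow> 'x free_word \<Rightarrow> 'x free_word" where
  "cancel_cons a [] = [a]"
| "cancel_cons a (b # w) = (if b = letter_inv a then w else a # b # w)"

definition reduce :: "'x free_word \<Rightarrow> 'x free_word" where
  "reduce w = foldr cancel_cons w []"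

definition free_group :: "'x set \<Rightarrow> 'x free_word monoid" where
  "free_group X =
    \<lparr>carrier = {w. reduced w \<and> fst ` set w \<subseteq> X}, mult = (\<lambda>u v. reduce (u @ v)), one = []\<rparr>"

lemma letter_inv_letter_inv [simp]: "letter_inv (letter_inv a) = a"
  by (simp add: letter_inv_def)

lemma letter_inv_neq [simp]: "letter_inv a \<noteq> a" "a \<noteq> letter_inv a"
  by (auto simp: letter_inv_def prod_eq_iff)

lemma fst_letter_inv [simp]: "fst (letter_inv a) = fst a"
  by (simp add: letter_inv_def)

lemma reduced_Nil [simp]: "reduced []"
  by (simp add: reduced_def)

lemma reduced_Cons:
  "reduced (a # w) \<longleftrightarrow> (w = [] \<or> hd w \<noteq> letter_inv a) \<and> reduced w"
  by (cases w) (auto simp: reduced_def)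

lemma reduced_cancel_cons: "reduced w \<Longrightarrow> reduced (cancel_cons a w)"
  by (cases w) (auto simp: reduced_Cons)

lemma reduced_foldr: "reduced v \<Longrightarrow> reduced (foldr cancel_cons u v)"
  by (induction u) (auto simp: reduced_cancel_cons)

lemma reduced_reduce: "reduced (reduce w)"
  by (simp add: reduce_def reduced_foldr)

lemma reduce_reduced: "reduced w \<Longrightarrow> reduce w = w"
proof (induction w)
  case (Cons a w)
  then show ?case by (cases w) (auto simp: reduce_def reduced_Cons)
qed (simp add: reduce_def)

lemma cancel_cons_inv:
  assumes "reduced w"
  shows "cancel_cons a (cancel_cons (letter_inv a) w) = w"
proof (cases w)
  case (Cons b v)
  then show ?thesis using assms by (cases v) (auto simp: reduced_Cons)
qed simp

lemma foldr_cancel_cons: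
  assumes "reduced v"
  shows "foldr cancel_cons (cancel_cons a u) v = cancel_cons a (foldr cancel_cons u v)"
proof (cases u)
  case (Cons b w)
  show ?thesis
    using cancel_cons_inv[of "foldr cancel_cons w v" a] reduced_foldr[OF assms, of w]
    by (auto simp: Cons)
qed simp

lemma foldr_reduce: "reduced v \<Longrightarrow> foldr cancel_cons (reduce u) v = foldr cancel_cons u v"
  by (induction u) (auto simp: reduce_def foldr_cancel_cons)

lemma reduce_append: "reduce (u @ v) = foldr cancel_cons u (reduce v)"
  by (simp add: reduce_def)

lemma reduce_append_left: "reduce (reduce u @ v) = reduce (u @ v)"
  by (simp add: reduce_append foldr_reduce reduced_reduce)

lemma reduce_append_right: "reduce (u @ reduce v) = reduce (u @ v)"
  by (simp add: reduce_append reduce_reduced reduced_reduce)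

lemma set_cancel_cons: "set (cancel_cons a w) \<subseteq> insert a (set w)"
  by (cases w) auto

lemma set_reduce: "set (reduce w) \<subseteq> set w"
proof (induction w)
  case (Cons a w)
  then show ?case using set_cancel_cons[of a "reduce w"] by (auto simp: reduce_def)
qed (simp add: reduce_def)

lemma reduce_inv_word: "reduce (rev (map letter_inv w) @ w) = []"
proof (induction w)
  case (Cons a w)
  have "cancel_cons (letter_inv a) (cancel_cons a (reduce w)) = reduce w"
    using cancel_cons_inv[OF reduced_reduce, of "letter_inv a" w] by simp
  then show ?case using Cons by (simp add: reduce_def)
qed (simp add: reduce_def)

lemma reduced_rev_inv: "reduced w \<Longrightarrow> reduced (rev (map letter_inv w))"
  unfolding reduced_def successively_rev successively_map
  by (erule successively_mono) (metis letter_inv_letter_inv)+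

lemma group_free_group: "group (free_group X)"
proof (rule groupI)
  fix u v assume "u \<in> carrier (free_group X)" "v \<in> carrier (free_group X)"
  then show "u \<otimes>\<^bsub>free_group X\<^esub> v \<in> carrier (free_group X)"
    using set_reduce[of "u @ v"] by (fastforce simp: free_group_def reduced_reduce)
next
  fix w assume w: "w \<in> carrier (free_group X)"
  show "\<exists>u\<in>carrier (free_group X). u \<otimes>\<^bsub>free_group X\<^esub> w = \<one>\<^bsub>free_group X\<^esub>"
    using w by (intro bexI[of _ "rev (map letter_inv w)"])
      (auto simp: free_group_def reduce_inv_word reduced_rev_inv)
qed (auto simp: free_group_def reduce_append_left reduce_append_right reduce_reduced)

text \<open>The image of \<open>w\<close> under the homomorphism sending each generator \<open>x\<close> to \<open>g x\<close>.\<close>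

definition word_eval :: "('a, 'm) monoid_scheme \<Rightarrow> ('x \<Rightarrow> 'a) \<Rightarrow> 'x free_word \<Rightarrow> 'a" where
  "word_eval G g w =
    foldr (\<lambda>(x, b) y. (if b then g x else inv\<^bsub>G\<^esub> (g x)) \<otimes>\<^bsub>G\<^esub> y) w \<one>\<^bsub>G\<^esub>"

definition free_basis :: "('a, 'm) monoid_scheme \<Rightarrow> 'a set \<Rightarrow> bool" where
  "free_basis F X \<longleftrightarrow>
    X \<subseteq> carrier F \<and> word_eval F (\<lambda>x. x) \<in> iso (free_group X) F"

definition is_free_group :: "('a, 'm) monoid_scheme \<Rightarrow> bool" where
  "is_free_group F \<longleftrightarrow> group F \<and> (\<exists>X. free_basis F X)"


section \<open>Outer commutator words and verbal subgroups\<close>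

definition commutator :: "('a, 'm) monoid_scheme \<Rightarrow> 'a \<Rightarrow> 'a \<Rightarrow> 'a" where
  "commutator G x y = inv\<^bsub>G\<^esub> x \<otimes>\<^bsub>G\<^esub> inv\<^bsub>G\<^esub> y \<otimes>\<^bsub>G\<^esub> x \<otimes>\<^bsub>G\<^esub> y"

text \<open>Words are elements of the free group on countably many variables. The variables are indexed
  from 0, and the two halves of a commutator may use any disjoint sets of them.\<close>

inductive outer_commutator :: "nat \<Rightarrow> nat free_word \<Rightarrow> bool" where
  var: "outer_commutator 1 [(i, True)]"
| comm: "outer_commutator s u \<Longrightarrow> outer_commutator t w \<Longrightarrow> fst ` set u \<inter> fst ` set w = {} \<Longrightarrow>
    outer_commutator (s + t) (commutator (free_group UNIV) u w)"

definition outer_commutator_words :: "nat free_word set" where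
  "outer_commutator_words = {v. \<exists>s. outer_commutator s v}"

definition word_values :: "nat free_word set \<Rightarrow> ('a, 'm) monoid_scheme \<Rightarrow> 'a set" where
  "word_values V G = {word_eval G g v | v g. v \<in> V \<and> (\<forall>i. g i \<in> carrier G)}"

definition verbal_subgroup :: "nat free_word set \<Rightarrow> ('a, 'm) monoid_scheme \<Rightarrow> 'a set" where
  "verbal_subgroup V G = generate G (word_values V G)"


section \<open>Free presentations and the invariant\<close>

definition free_presentation ::
    "('a, 'm) monoid_scheme \<Rightarrow> ('b, 'n) monoid_scheme \<Rightarrow> ('a \<Rightarrow> 'b) \<Rightarrow> bool" where
  "free_presentation F G \<pi> \<longleftrightarrow> is_free_group F \<and> group G \<and> \<pi> \<in> epi F G"

definition B0_numerator ::
    "nat free_word set \<Rightarrow> ('a, 'm) monoid_scheme \<Rightarrow> ('b, 'n) monoid_scheme \<Rightarrow> ('a \<Rightarrow> 'b) \<Rightarrow> 'a set"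
  where "B0_numerator V F G \<pi> = kernel F G \<pi> \<inter> verbal_subgroup V F"

definition B0_denominator ::
    "nat free_word set \<Rightarrow> ('a, 'm) monoid_scheme \<Rightarrow> ('b, 'n) monoid_scheme \<Rightarrow> ('a \<Rightarrow> 'b) \<Rightarrow> 'a set"
  where "B0_denominator V F G \<pi> = generate F (word_values V F \<inter> kernel F G \<pi>)"

definition B0 ::
    "nat free_word set \<Rightarrow> ('a, 'm) monoid_scheme \<Rightarrow> ('b, 'n) monoid_scheme \<Rightarrow> ('a \<Rightarrow> 'b) \<Rightarrow>
      'a set monoid"
  where "B0 V F G \<pi> =
    (F\<lparr>carrier := B0_numerator V F G \<pi>\<rparr>) Mod B0_denominator V F G \<pi>"

lemma word_eval_closed:
  assumes "group G" and "\<And>x. g x \<in> carrier G"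
  shows "word_eval G g w \<in> carrier G"
proof -
  interpret group G by fact
  show ?thesis by (induction w) (auto simp: word_eval_def assms)
qed

lemma word_eval_hom:
  assumes "group G" "group H" "h \<in> hom G H" and "\<And>x. g x \<in> carrier G"
  shows "h (word_eval G g w) = word_eval H (\<lambda>x. h (g x)) w"
proof -
  interpret group_hom G H h
    using assms by (simp add: group_hom_def group_hom_axioms_def)
  have closed: "word_eval G g w \<in> carrier G" for w
    using word_eval_closed[OF assms(1,4)] .
  have step: "word_eval G g ((x, b) # w) =
      (if b then g x else inv\<^bsub>G\<^esub> (g x)) \<otimes>\<^bsub>G\<^esub> word_eval G g w" for x b w
    by (simp add: word_eval_def)
  have step': "word_eval H (\<lambda>x. h (g x)) ((x, b) # w) =
      (if b then h (g x) else inv\<^bsub>H\<^esub> (h (g x))) \<otimes>\<^bsub>H\<^esub> word_eval H (\<lambda>x. h (g x)) w" for x b w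
    by (simp add: word_eval_def)
  show ?thesis
  proof (induction w)
    case Nil
    then show ?case by (simp add: word_eval_def)
  next
    case (Cons a w)
    then show ?case by (cases a) (auto simp: step step' closed assms(4))
  qed
qed

lemma B0_denominator_normal:
  assumes "free_presentation F G \<pi>"
  shows "B0_denominator V F G \<pi> \<lhd> F"
proof -
  interpret group_hom F G \<pi>
    using assms
    by (auto simp: free_presentation_def is_free_group_def epi_def group_hom_def group_hom_axioms_def)
  have ker: "kernel F G \<pi> \<lhd> F" by (rule normal_kernel)
  have conj_hom: "(\<lambda>x. y \<otimes>\<^bsub>F\<^esub> x \<otimes>\<^bsub>F\<^esub> inv\<^bsub>F\<^esub> y) \<in> hom F F" if y: "y \<in> carrier F" for y
  proof (rule homI)
    fix x z assume xz: "x \<in> carrier F" "z \<in> carrier F"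
    have "inv\<^bsub>F\<^esub> y \<otimes>\<^bsub>F\<^esub> (y \<otimes>\<^bsub>F\<^esub> (z \<otimes>\<^bsub>F\<^esub> inv\<^bsub>F\<^esub> y)) = z \<otimes>\<^bsub>F\<^esub> inv\<^bsub>F\<^esub> y"
      using y xz by (intro G.inv_solve_left'[THEN iffD2]) auto
    then show "y \<otimes>\<^bsub>F\<^esub> (x \<otimes>\<^bsub>F\<^esub> z) \<otimes>\<^bsub>F\<^esub> inv\<^bsub>F\<^esub> y =
        (y \<otimes>\<^bsub>F\<^esub> x \<otimes>\<^bsub>F\<^esub> inv\<^bsub>F\<^esub> y) \<otimes>\<^bsub>F\<^esub> (y \<otimes>\<^bsub>F\<^esub> z \<otimes>\<^bsub>F\<^esub> inv\<^bsub>F\<^esub> y)"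
      using y xz by (simp add: G.m_assoc)
  qed (use y in simp)
  show ?thesis
    unfolding B0_denominator_def
  proof (rule G.normal_generateI)
    show "word_values V F \<inter> kernel F G \<pi> \<subseteq> carrier F"
      by (auto simp: kernel_def)
  next
    fix h y assume h: "h \<in> word_values V F \<inter> kernel F G \<pi>" and y: "y \<in> carrier F"
    then obtain v g where vg: "v \<in> V" "\<And>i. g i \<in> carrier F" "h = word_eval F g v"
      unfolding word_values_def by blast
    have "y \<otimes>\<^bsub>F\<^esub> h \<otimes>\<^bsub>F\<^esub> inv\<^bsub>F\<^esub> y = word_eval F (\<lambda>i. y \<otimes>\<^bsub>F\<^esub> g i \<otimes>\<^bsub>F\<^esub> inv\<^bsub>F\<^esub> y) v"
      using word_eval_hom[where g = g and w = v, OF G.is_group G.is_group conj_hom[OF y] vg(2)] vg(3)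
      by simp
    moreover have "y \<otimes>\<^bsub>F\<^esub> g i \<otimes>\<^bsub>F\<^esub> inv\<^bsub>F\<^esub> y \<in> carrier F" for i
      using y vg(2) by simp
    ultimately have "y \<otimes>\<^bsub>F\<^esub> h \<otimes>\<^bsub>F\<^esub> inv\<^bsub>F\<^esub> y \<in> word_values V F"
      unfolding word_values_def using vg(1) by blast
    then show "y \<otimes>\<^bsub>F\<^esub> h \<otimes>\<^bsub>F\<^esub> inv\<^bsub>F\<^esub> y \<in> word_values V F \<inter> kernel F G \<pi>"
      using normal.inv_op_closed2[OF ker y] h by blast
  qed
qed

lemma group_B0:
  assumes "free_presentation F G \<pi>"
  shows "B0_denominator V F G \<pi> \<lhd> F\<lparr>carrier := B0_numerator V F G \<pi>\<rparr>"
    and "group (B0 V F G \<pi>)"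
proof -
  interpret group_hom F G \<pi>
    using assms
    by (auto simp: free_presentation_def is_free_group_def epi_def group_hom_def group_hom_axioms_def)
  have T: "word_values V F \<subseteq> carrier F"
    using word_eval_closed[OF G.is_group] by (auto simp: word_values_def)
  have num: "subgroup (B0_numerator V F G \<pi>) F"
    unfolding B0_numerator_def verbal_subgroup_def
    by (intro G.subgroups_Inter_pair subgroup_kernel G.generate_is_subgroup T)
  have sub: "B0_denominator V F G \<pi> \<subseteq> B0_numerator V F G \<pi>"
    unfolding B0_denominator_def
    by (rule G.generate_subgroup_incl[OF _ num])
      (auto simp: B0_numerator_def verbal_subgroup_def intro: generate.incl)
  show 1: "B0_denominator V F G \<pi> \<lhd> F\<lparr>carrier := B0_numerator V F G \<pi>\<rparr>"
    by (rule G.normal_restrict_supergroup[OF num B0_denominator_normal[OF assms] sub])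
  show "group (B0 V F G \<pi>)"
    unfolding B0_def using 1 by (rule normal.factorgroup_is_group)
qed

definition is_lift ::
    "('a, 'm) monoid_scheme \<Rightarrow> ('a \<Rightarrow> 'b) \<Rightarrow> ('c, 'k) monoid_scheme \<Rightarrow> ('c \<Rightarrow> 'd) \<Rightarrow>
      ('b \<Rightarrow> 'd) \<Rightarrow> ('a \<Rightarrow> 'c) \<Rightarrow> bool" where
  "is_lift F \<pi> F' \<pi>' \<alpha> \<beta> \<longleftrightarrow>
    \<beta> \<in> hom F F' \<and> (\<forall>x\<in>carrier F. \<alpha> (\<pi> x) = \<pi>' (\<beta> x))"

text \<open>The coset \<open>x\<langle>T(F) \<inter> R\<rangle>\<close>; since \<open>\<langle>T(F) \<inter> R\<rangle>\<close> is normal, left and right cosets agree, and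
  the right coset is the form used by \<^const>\<open>FactGroup\<close>.\<close>

definition B0_class ::
    "nat free_word set \<Rightarrow> ('a, 'm) monoid_scheme \<Rightarrow> ('b, 'n) monoid_scheme \<Rightarrow> ('a \<Rightarrow> 'b) \<Rightarrow>
      'a \<Rightarrow> 'a set" where
  "B0_class V F G \<pi> x = B0_denominator V F G \<pi> #>\<^bsub>F\<^esub> x"

text \<open>The homomorphism \<open>\<alpha>\<^sup>*\<close>, made unique as a HOL function by being \<open>undefined\<close> off the carrier.\<close>

definition B0_hom ::
    "nat free_word set \<Rightarrow> ('a, 'm) monoid_scheme \<Rightarrow> ('b, 'n) monoid_scheme \<Rightarrow> ('a \<Rightarrow> 'b) \<Rightarrow>
      ('c, 'k) monoid_scheme \<Rightarrow> ('d, 'l) monoid_scheme \<Rightarrow> ('c \<Rightarrow> 'd) \<Rightarrow>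
      ('b \<Rightarrow> 'd) \<Rightarrow> 'a set \<Rightarrow> 'c set" where
  "B0_hom V F G \<pi> F' G' \<pi>' \<alpha> = (THE \<phi>.
    \<phi> \<in> extensional (carrier (B0 V F G \<pi>)) \<and>
    \<phi> \<in> hom (B0 V F G \<pi>) (B0 V F' G' \<pi>') \<and>
    (\<forall>\<beta>. is_lift F \<pi> F' \<pi>' \<alpha> \<beta> \<longrightarrow>
      (\<forall>x\<in>B0_numerator V F G \<pi>. \<phi> (B0_class V F G \<pi> x) = B0_class V F' G' \<pi>' (\<beta> x))))"

end

theory Submission
  imports Defs
begin

text \<open>
  Lifts exist because \<open>F\<close> is free: the images of a basis may be chosen freely among the preimages
  under \<open>\<pi>'\<close> (lemma \<open>lift_exists\<close>). A lift is a homomorphism of the presentations, hence it carries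
  word values to word values and \<open>R\<close> into \<open>R'\<close>, and so induces a map of the quotients.

  The point of the theorem is that the induced map does not see the choice of the lift, and here the
  shape of the words matters. Two lifts \<open>\<beta>\<close> and \<open>\<beta>'\<close> agree modulo \<open>R'\<close>, so for a word \<open>v \<in> V\<close> the
  elements \<open>\<beta>(v(g))\<close> and \<open>\<beta>'(v(g))\<close> are the values of \<open>v\<close> at two tuples that are congruent modulo
  \<open>R'\<close>. For an arbitrary word this shows only that they differ by an element of \<open>R'\<close>. For an outer
  commutator word they differ by an element of \<open>\<langle>T(F') \<inter> R'\<rangle>\<close>, where \<open>T(F')\<close> may even be taken for the
  single word \<open>v\<close> (lemma \<open>outer_commutator_congruent\<close>). The proof is by induction on \<open>v = [u, w]\<close>.
  By induction, passing to a congruent tuple multiplies the value of \<open>u\<close> by a product \<open>a\<close> of values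
  of \<open>u\<close> lying in \<open>R'\<close> and their inverses, and similarly the value of \<open>w\<close> by some \<open>b\<close>. Since \<open>u\<close> and
  \<open>w\<close> have no variable in common, the commutator of any value of \<open>u\<close> with any value of \<open>w\<close> is a value
  of \<open>v\<close>; if one of the two lies in \<open>R'\<close>, so does the commutator, as \<open>R'\<close> is normal. Hence, modulo
  \<open>\<langle>T(F') \<inter> R'\<rangle>\<close>, the element \<open>a\<close> commutes with all values of \<open>w\<close>, and \<open>b\<close> with all values of \<open>u\<close>.
  Writing \<open>[ua, w] = (ua)\<^sup>-\<^sup>1 w\<^sup>-\<^sup>1 (ua) w = a\<^sup>-\<^sup>1 (u\<^sup>-\<^sup>1 w u)\<^sup>-\<^sup>1 a w\<close> shows that \<open>[ua, w] = [u, w]\<close> as soon as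
  \<open>a\<close> commutes with the conjugate \<open>u\<^sup>-\<^sup>1 w u\<close>, which is again a value of \<open>w\<close>; symmetrically \<open>b\<close> can
  be removed from the second argument.

  Everything else is formal: the induced map is characterised by its values on the classes, so a
  composite of lifts gives the composite of the induced maps, the identity induces the identity, and
  two presentations of the same group have inverse maps between their invariants.
\<close>

section \<open>Evaluation of words\<close>

lemma word_eval_cong:
  "(\<And>x. x \<in> fst ` set w \<Longrightarrow> g x = g' x) \<Longrightarrow> word_eval G g w = word_eval G g' w"
  by (induction w) (auto simp: word_eval_def)

lemma word_eval_Nil [simp]: "word_eval G g [] = \<one>\<^bsub>G\<^esub>"
  by (simp add: word_eval_def)

lemma word_eval_Cons:
  "word_eval G g (a # w) =
    (if snd a then g (fst a) else inv\<^bsub>G\<^esub> (g (fst a))) \<otimes>\<^bsub>G\<^esub> word_eval G g w"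
  by (simp add: word_eval_def split_beta)

lemma word_eval_append:
  assumes "group G" and "\<And>x. g x \<in> carrier G"
  shows "word_eval G g (u @ w) = word_eval G g u \<otimes>\<^bsub>G\<^esub> word_eval G g w"
proof -
  interpret group G by fact
  show ?thesis
    by (induction u) (simp_all add: word_eval_Cons word_eval_closed[OF assms] assms(2) m_assoc)
qed

text \<open>
  Cancelling a letter against its inverse does not change the value in a group; hence evaluation is
  multiplicative for the reduced product of the free group.
\<close>

lemma word_eval_reduce:
  fixes G (structure)
  assumes "group G" and "\<And>x. g x \<in> carrier G"
  shows "word_eval G g (reduce w) = word_eval G g w"
proof -
  interpret group G by fact
  note closed = word_eval_closed[where g = g, OF assms]
  have cancel: "word_eval G g (cancel_cons a w) = word_eval G g (a # w)" for a w
  proof (cases w)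
    case (Cons b w')
    have "g x \<otimes> (inv (g x) \<otimes> word_eval G g w') = word_eval G g w'"
      and "inv (g x) \<otimes> (g x \<otimes> word_eval G g w') = word_eval G g w'" for x
      using closed[of w'] assms(2)[of x] by (simp_all flip: m_assoc)
    then show ?thesis
      using Cons by (simp add: letter_inv_def word_eval_Cons)
  qed simp
  show ?thesis
  proof (induction w)
    case (Cons a w)
    have "word_eval G g (reduce (a # w)) = word_eval G g (a # reduce w)"
      using cancel[of a "reduce w"] by (simp add: reduce_def)
    then show ?case using Cons by (simp add: word_eval_Cons)
  qed (simp add: reduce_def)
qed

lemma word_eval_hom_free_group:
  assumes "group G" and "\<And>x. g x \<in> carrier G"
  shows "word_eval G g \<in> hom (free_group X) G"
  by (rule homI)
    (simp_all add: word_eval_closed[OF assms] free_group_def word_eval_reduce[OF assms]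
      word_eval_append[OF assms])

lemma hom_commutator:
  assumes "group G" "group H" "h \<in> hom G H" "x \<in> carrier G" "y \<in> carrier G"
  shows "h (commutator G x y) = commutator H (h x) (h y)"
proof -
  interpret group_hom G H h
    using assms by (simp add: group_hom_def group_hom_axioms_def)
  show ?thesis using assms(4,5) by (simp add: commutator_def)
qed

lemma (in group) commutator_closed:
  "x \<in> carrier G \<Longrightarrow> y \<in> carrier G \<Longrightarrow> commutator G x y \<in> carrier G"
  by (simp add: commutator_def)

lemma outer_commutator_in_free_group:
  "outer_commutator s v \<Longrightarrow> v \<in> carrier (free_group UNIV)"
proof (induction rule: outer_commutator.induct)
  case (var i)
  then show ?case by (simp add: free_group_def reduced_Cons)
next
  case (comm s u t w)
  then show ?case by (simp add: group.commutator_closed[OF group_free_group])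
qed

lemma word_eval_commutator:
  assumes "group G" and "\<And>x. g x \<in> carrier G"
    and "u \<in> carrier (free_group UNIV)" "w \<in> carrier (free_group UNIV)"
  shows "word_eval G g (commutator (free_group UNIV) u w) =
    commutator G (word_eval G g u) (word_eval G g w)"
  by (rule hom_commutator[OF group_free_group assms(1) word_eval_hom_free_group[OF assms(1,2)]
        assms(3,4)])

section \<open>Verbal values\<close>

lemma word_valuesI:
  "v \<in> V \<Longrightarrow> (\<And>i. g i \<in> carrier G) \<Longrightarrow> word_eval G g v \<in> word_values V G"
  by (auto simp: word_values_def)

lemma word_values_closed: "group G \<Longrightarrow> word_values V G \<subseteq> carrier G"
  by (auto simp: word_values_def intro: word_eval_closed)

lemma hom_word_values:
  assumes "group G" "group H" "h \<in> hom G H" "x \<in> word_values V G"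
  shows "h x \<in> word_values V H"
proof -
  obtain v g where "v \<in> V" "\<And>i. g i \<in> carrier G" "x = word_eval G g v"
    using assms(4) by (auto simp: word_values_def)
  then show ?thesis
    using word_eval_hom[where g = g and w = v, OF assms(1-3)] hom_in_carrier[OF assms(3)]
    by (auto intro: word_valuesI)
qed

text \<open>Conjugation is an endomorphism, and homomorphisms preserve word values.\<close>

lemma (in group) conj_word_values:
  assumes "x \<in> word_values V G" "y \<in> carrier G"
  shows "inv y \<otimes> x \<otimes> y \<in> word_values V G"
proof -
  have "(\<lambda>x. inv y \<otimes> x \<otimes> y) \<in> hom G G"
  proof (rule homI)
    fix a b assume ab: "a \<in> carrier G" "b \<in> carrier G"
    have "y \<otimes> (inv y \<otimes> (b \<otimes> y)) = b \<otimes> y"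
      using assms(2) ab by (simp flip: m_assoc)
    then show "inv y \<otimes> (a \<otimes> b) \<otimes> y = (inv y \<otimes> a \<otimes> y) \<otimes> (inv y \<otimes> b \<otimes> y)"
      using assms(2) ab by (simp add: m_assoc)
  qed (use assms(2) in simp)
  from hom_word_values[OF is_group is_group this assms(1)] show ?thesis .
qed

text \<open>Disjointness of the variables lets the arguments of the two halves be chosen
  independently of each other.\<close>

lemma commutator_word_values:
  assumes "group G"
    and u: "u \<in> carrier (free_group UNIV)" and w: "w \<in> carrier (free_group UNIV)"
    and disj: "fst ` set u \<inter> fst ` set w = {}"
    and a: "a \<in> word_values {u} G" and b: "b \<in> word_values {w} G"
  shows "commutator G a b \<in> word_values {commutator (free_group UNIV) u w} G"
proof -
  obtain f where f: "\<And>i. f i \<in> carrier G" "a = word_eval G f u"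
    using a by (auto simp: word_values_def)
  obtain g where g: "\<And>i. g i \<in> carrier G" "b = word_eval G g w"
    using b by (auto simp: word_values_def)
  define k where "k i = (if i \<in> fst ` set u then f i else g i)" for i
  have k: "k i \<in> carrier G" for i using f(1) g(1) by (simp add: k_def)
  have "word_eval G k u = a"
    unfolding f(2) by (rule word_eval_cong) (simp add: k_def)
  moreover have "word_eval G k w = b"
    unfolding g(2) using disj by (intro word_eval_cong) (auto simp: k_def)
  moreover have "word_eval G k (commutator (free_group UNIV) u w) \<in>
      word_values {commutator (free_group UNIV) u w} G"
    by (rule word_valuesI) (simp_all add: k)
  ultimately show ?thesis
    using word_eval_commutator[where g = k, OF assms(1) k u w] by simp
qed

section \<open>Commuting elements and commutators\<close>

text \<open>
  With \<open>z = u\<^sup>-\<^sup>1 w u\<close> one has \<open>[ua, w] = a\<^sup>-\<^sup>1 z\<^sup>-\<^sup>1 a w\<close> and \<open>[u, w] = z\<^sup>-\<^sup>1 w\<close>. In the next lemma, with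
  \<open>z = w\<^sup>-\<^sup>1 u w\<close>, likewise \<open>[u, wb] = u\<^sup>-\<^sup>1 b\<^sup>-\<^sup>1 z b\<close> and \<open>[u, w] = u\<^sup>-\<^sup>1 z\<close>.
\<close>

lemma (in group) commutator_mult_left:
  assumes "u \<in> carrier G" "a \<in> carrier G" "w \<in> carrier G"
    and comm: "a \<otimes> (inv u \<otimes> w \<otimes> u) = (inv u \<otimes> w \<otimes> u) \<otimes> a"
  shows "commutator G (u \<otimes> a) w = commutator G u w"
proof -
  let ?z = "inv u \<otimes> w \<otimes> u"
  have z: "?z \<in> carrier G" using assms by simp
  have "?z = inv a \<otimes> (?z \<otimes> a)"
    using comm assms(2) z by (metis inv_solve_left m_closed)
  then have "inv ?z = inv (inv a \<otimes> (?z \<otimes> a))" by simp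
  also have "\<dots> = inv a \<otimes> inv ?z \<otimes> a" using assms(2) z by (simp add: inv_mult_group m_assoc)
  finally have "inv a \<otimes> inv ?z \<otimes> a = inv ?z" by simp
  moreover have "inv ?z = inv u \<otimes> inv w \<otimes> u"
    using assms(1,3) by (simp add: inv_mult_group m_assoc)
  moreover have "commutator G (u \<otimes> a) w = inv a \<otimes> (inv u \<otimes> inv w \<otimes> u) \<otimes> a \<otimes> w"
    using assms(1-3) by (simp add: commutator_def inv_mult_group m_assoc)
  ultimately show ?thesis by (simp add: commutator_def)
qed

lemma (in group) commutator_mult_right:
  assumes "u \<in> carrier G" "w \<in> carrier G" "b \<in> carrier G"
    and comm: "b \<otimes> (inv w \<otimes> u \<otimes> w) = (inv w \<otimes> u \<otimes> w) \<otimes> b"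
  shows "commutator G u (w \<otimes> b) = commutator G u w"
proof -
  let ?z = "inv w \<otimes> u \<otimes> w"
  have z: "?z \<in> carrier G" using assms by simp
  have "inv b \<otimes> ?z \<otimes> b = ?z"
    using comm assms(3) z by (metis inv_solve_left m_assoc m_closed inv_closed)
  moreover have "commutator G u (w \<otimes> b) = inv u \<otimes> (inv b \<otimes> ?z \<otimes> b)"
    using assms(1-3) by (simp add: commutator_def inv_mult_group m_assoc)
  ultimately show ?thesis using assms(1-3) by (simp add: commutator_def m_assoc)
qed

lemma (in group) commute_if_commutator_one:
  assumes "x \<in> carrier G" "y \<in> carrier G" "commutator G x y = \<one>"
  shows "x \<otimes> y = y \<otimes> x"
proof -
  have "inv (y \<otimes> x) \<otimes> (x \<otimes> y) = \<one>"
    using assms by (simp add: commutator_def inv_mult_group m_assoc)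
  then show ?thesis
    using assms(1,2) by (metis inv_equality inv_inv inv_closed m_closed)
qed

text \<open>The elements whose image commutes with \<open>y\<close> form a subgroup, so it suffices to test generators.\<close>

lemma commute_generate:
  assumes "group_hom G H h" "S \<subseteq> carrier G" "y \<in> carrier H"
    and "\<And>x. x \<in> S \<Longrightarrow> h x \<otimes>\<^bsub>H\<^esub> y = y \<otimes>\<^bsub>H\<^esub> h x" and "x \<in> generate G S"
  shows "h x \<otimes>\<^bsub>H\<^esub> y = y \<otimes>\<^bsub>H\<^esub> h x"
proof -
  interpret group_hom G H h by fact
  have inv_commute: "inv\<^bsub>H\<^esub> a \<otimes>\<^bsub>H\<^esub> y = y \<otimes>\<^bsub>H\<^esub> inv\<^bsub>H\<^esub> a"
    if "a \<in> carrier H" "a \<otimes>\<^bsub>H\<^esub> y = y \<otimes>\<^bsub>H\<^esub> a" for a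
    using that assms(3) by (metis H.inv_closed H.inv_solve_left H.inv_solve_right H.m_assoc H.m_closed)
  show ?thesis using assms(5)
  proof (induction rule: generate.induct)
    case one
    then show ?case using assms(3) by simp
  next
    case (incl a)
    then show ?case using assms(4) by simp
  next
    case (inv a)
    then show ?case using assms(2,4) inv_commute[of "h a"] by (auto simp: subset_iff)
  next
    case (eng a b)
    then have "a \<in> carrier G" "b \<in> carrier G"
      using G.generate_in_carrier[OF assms(2)] by auto
    with eng assms(3) show ?case
      by (metis H.m_assoc hom_closed hom_mult)
  qed
qed

section \<open>The class map as a homomorphism\<close>

lemma free_presentation_group_hom: "free_presentation F G \<pi> \<Longrightarrow> group_hom F G \<pi>"
  by (auto simp: free_presentation_def is_free_group_def epi_def group_hom_def group_hom_axioms_def)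

lemma B0_class_hom:
  "free_presentation F G \<pi> \<Longrightarrow> group_hom F (F Mod B0_denominator V F G \<pi>) (B0_class V F G \<pi>)"
  using normal.r_coset_hom_Mod[OF B0_denominator_normal, of F G \<pi> V]
    normal.factorgroup_is_group[OF B0_denominator_normal, of F G \<pi> V]
    group_hom.axioms(1)[OF free_presentation_group_hom, of F G \<pi>]
  by (simp add: group_hom_def group_hom_axioms_def B0_class_def[abs_def])

lemma B0_class_eq_iff:
  assumes pres: "free_presentation F G \<pi>" and "x \<in> carrier F" "y \<in> carrier F"
  shows "B0_class V F G \<pi> x = B0_class V F G \<pi> y \<longleftrightarrow>
    inv\<^bsub>F\<^esub> y \<otimes>\<^bsub>F\<^esub> x \<in> B0_denominator V F G \<pi>"
proof -
  let ?N = "B0_denominator V F G \<pi>" and ?p = "B0_class V F G \<pi>"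
  define Q where "Q = F Mod ?N"
  interpret group_hom F Q ?p unfolding Q_def by (rule B0_class_hom[OF pres])
  interpret N: normal ?N F using B0_denominator_normal[OF pres] .
  have one: "?p z = \<one>\<^bsub>Q\<^esub> \<longleftrightarrow> z \<in> ?N" if "z \<in> carrier F" for z
    using that G.rcos_self[OF _ N.is_subgroup] G.coset_join2[OF _ N.is_subgroup]
    by (fastforce simp: B0_class_def Q_def FactGroup_def)
  have "?p x = ?p y \<longleftrightarrow> inv\<^bsub>Q\<^esub> (?p y) \<otimes>\<^bsub>Q\<^esub> ?p x = \<one>\<^bsub>Q\<^esub>"
    using assms(2,3) H.inv_solve_left'[of "\<one>\<^bsub>Q\<^esub>" "?p y" "?p x"] by simp
  also have "\<dots> \<longleftrightarrow> ?p (inv\<^bsub>F\<^esub> y \<otimes>\<^bsub>F\<^esub> x) = \<one>\<^bsub>Q\<^esub>"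
    using assms(2,3) by simp
  also have "\<dots> \<longleftrightarrow> inv\<^bsub>F\<^esub> y \<otimes>\<^bsub>F\<^esub> x \<in> ?N"
    using assms(2,3) by (intro one) simp
  finally show ?thesis .
qed

lemma B0_denominator_mono:
  "group F \<Longrightarrow> V \<subseteq> W \<Longrightarrow> B0_denominator V F G \<pi> \<subseteq> B0_denominator W F G \<pi>"
  unfolding B0_denominator_def by (rule group.mono_generate) (auto simp: word_values_def)

section \<open>Values of outer commutator words at congruent arguments\<close>

text \<open>
  The heart of the matter: for an outer commutator word, a change of the arguments by elements of the
  kernel \<open>R\<close> changes the value only by a product of values of the same word that lie in \<open>R\<close>, and
  their inverses. The statement is about \<open>{v}\<close> rather than a set of words so that the induction
  hypotheses speak of the values of the two halves \<open>u\<close> and \<open>w\<close> separately.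
\<close>

lemma outer_commutator_congruent:
  assumes pres: "free_presentation F G \<pi>"
    and f: "\<And>i. f i \<in> carrier F" and g: "\<And>i. g i \<in> carrier F"
    and cong: "\<And>i. \<pi> (f i) = \<pi> (g i)"
    and v: "outer_commutator s v"
  shows "inv\<^bsub>F\<^esub> (word_eval F g v) \<otimes>\<^bsub>F\<^esub> word_eval F f v \<in> B0_denominator {v} F G \<pi>"
  using v
proof (induction rule: outer_commutator.induct)
  case (var i)
  interpret group_hom F G \<pi> using free_presentation_group_hom[OF pres] .
  \<comment> \<open>Every element is a value of a variable.\<close>
  have "inv\<^bsub>F\<^esub> (g i) \<otimes>\<^bsub>F\<^esub> f i = word_eval F (\<lambda>_. inv\<^bsub>F\<^esub> (g i) \<otimes>\<^bsub>F\<^esub> f i) [(i, True)]"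
    using f g by (simp add: word_eval_def)
  also have "\<dots> \<in> word_values {[(i, True)]} F" using f g by (intro word_valuesI) auto
  finally have "inv\<^bsub>F\<^esub> (g i) \<otimes>\<^bsub>F\<^esub> f i \<in> word_values {[(i, True)]} F \<inter> kernel F G \<pi>"
    using f g cong by (simp add: kernel_def)
  then show ?case
    using f g by (simp add: B0_denominator_def word_eval_def generate.incl)
next
  case (comm s u t w)
  let ?v = "commutator (free_group UNIV) u w" and ?R = "kernel F G \<pi>"
  let ?p = "B0_class {?v} F G \<pi>"
  \<comment> \<open>The quotient is named so that the simplifier treats it as an abstract group instead of
    computing with cosets.\<close>
  define Q where "Q = F Mod B0_denominator {?v} F G \<pi>"
  interpret group_hom F G \<pi> using free_presentation_group_hom[OF pres] .
  interpret p: group_hom F Q ?p unfolding Q_def by (rule B0_class_hom[OF pres])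
  have words: "u \<in> carrier (free_group UNIV)" "w \<in> carrier (free_group UNIV)"
    using comm.hyps(1,2) outer_commutator_in_free_group by auto
  note T = word_values_closed[OF G.is_group]
  have trivial: "?p x = \<one>\<^bsub>Q\<^esub>" if "x \<in> word_values {?v} F" "\<pi> x = \<one>\<^bsub>G\<^esub>" for x
  proof -
    have x: "x \<in> carrier F" using that(1) T by blast
    then have "inv\<^bsub>F\<^esub> \<one>\<^bsub>F\<^esub> \<otimes>\<^bsub>F\<^esub> x \<in> B0_denominator {?v} F G \<pi>"
      using that by (simp add: B0_denominator_def kernel_def generate.incl)
    then show ?thesis
      using B0_class_eq_iff[OF pres x G.one_closed, of "{?v}"] p.hom_one by simp
  qed
  have commute: "?p a \<otimes>\<^bsub>Q\<^esub> ?p b = ?p b \<otimes>\<^bsub>Q\<^esub> ?p a"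
    if "a \<in> word_values {u} F" "b \<in> word_values {w} F" "\<pi> a = \<one>\<^bsub>G\<^esub> \<or> \<pi> b = \<one>\<^bsub>G\<^esub>" for a b
  proof -
    have ab: "a \<in> carrier F" "b \<in> carrier F" using that(1,2) T by blast+
    have "\<pi> (commutator F a b) = \<one>\<^bsub>G\<^esub>"
      using that(3) ab by (auto simp: commutator_def)
    then have "?p (commutator F a b) = \<one>\<^bsub>Q\<^esub>"
      using trivial commutator_word_values[OF G.is_group words comm.hyps(3) that(1,2)] by blast
    then show ?thesis
      using ab hom_commutator[OF G.is_group p.H.is_group p.homh ab]
      by (intro p.H.commute_if_commutator_one) auto
  qed
  \<comment> \<open>The factors by which the values of the two halves change; by induction they are products of
    values of \<open>u\<close> and of \<open>w\<close> in the kernel.\<close>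
  define a where "a = inv\<^bsub>F\<^esub> (word_eval F g u) \<otimes>\<^bsub>F\<^esub> word_eval F f u"
  define b where "b = inv\<^bsub>F\<^esub> (word_eval F g w) \<otimes>\<^bsub>F\<^esub> word_eval F f w"
  define ug wg uf wf where defs: "ug = word_eval F g u" "wg = word_eval F g w"
    "uf = word_eval F f u" "wf = word_eval F f w"
  have carr: "ug \<in> carrier F" "wg \<in> carrier F" "uf \<in> carrier F" "wf \<in> carrier F"
    using f g by (simp_all add: defs word_eval_closed[OF G.is_group])
  have ab: "a \<in> carrier F" "b \<in> carrier F" "uf = ug \<otimes>\<^bsub>F\<^esub> a" "wf = wg \<otimes>\<^bsub>F\<^esub> b"
    using carr unfolding a_def b_def defs[symmetric]
    by (simp_all flip: G.m_assoc)
  have T_ker: "word_values {c} F \<inter> ?R \<subseteq> carrier F" for c using T by blast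
  have a_commute: "?p a \<otimes>\<^bsub>Q\<^esub> ?p y = ?p y \<otimes>\<^bsub>Q\<^esub> ?p a" if y: "y \<in> word_values {w} F" for y
  proof (rule commute_generate[OF p.group_hom_axioms T_ker])
    show "?p y \<in> carrier Q" using y T by (meson p.hom_closed subsetD)
    show "?p x \<otimes>\<^bsub>Q\<^esub> ?p y = ?p y \<otimes>\<^bsub>Q\<^esub> ?p x" if "x \<in> word_values {u} F \<inter> ?R" for x
      using that y by (intro commute) (simp_all add: kernel_def)
    show "a \<in> generate F (word_values {u} F \<inter> ?R)"
      using comm.IH(1) by (simp add: B0_denominator_def a_def)
  qed
  have b_commute: "?p b \<otimes>\<^bsub>Q\<^esub> ?p y = ?p y \<otimes>\<^bsub>Q\<^esub> ?p b" if y: "y \<in> word_values {u} F" for y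
  proof (rule commute_generate[OF p.group_hom_axioms T_ker])
    show "?p y \<in> carrier Q" using y T by (meson p.hom_closed subsetD)
    show "?p x \<otimes>\<^bsub>Q\<^esub> ?p y = ?p y \<otimes>\<^bsub>Q\<^esub> ?p x" if "x \<in> word_values {w} F \<inter> ?R" for x
      using that y by (intro commute[symmetric]) (simp_all add: kernel_def)
    show "b \<in> generate F (word_values {w} F \<inter> ?R)"
      using comm.IH(2) by (simp add: B0_denominator_def b_def)
  qed
  have "ug \<in> word_values {u} F" "wf \<in> word_values {w} F"
    using f g by (auto simp: defs intro: word_valuesI)
  then have conj: "inv\<^bsub>F\<^esub> ug \<otimes>\<^bsub>F\<^esub> wf \<otimes>\<^bsub>F\<^esub> ug \<in> word_values {w} F"
    "inv\<^bsub>F\<^esub> wg \<otimes>\<^bsub>F\<^esub> ug \<otimes>\<^bsub>F\<^esub> wg \<in> word_values {u} F"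
    using carr by (auto intro: G.conj_word_values)
  \<comment> \<open>First \<open>a\<close> is removed while the second argument is still \<open>wg b\<close>, itself the value \<open>wf\<close>
    of \<open>w\<close>; then \<open>b\<close> is removed.\<close>
  note p_commutator = hom_commutator[OF G.is_group p.H.is_group p.homh]
  have "?p (commutator F uf wf) = commutator Q (?p ug \<otimes>\<^bsub>Q\<^esub> ?p a) (?p wf)"
    using carr ab by (simp add: p_commutator)
  also have "\<dots> = commutator Q (?p ug) (?p wf)"
    using a_commute[OF conj(1)] carr ab by (intro p.H.commutator_mult_left) auto
  also have "\<dots> = commutator Q (?p ug) (?p wg \<otimes>\<^bsub>Q\<^esub> ?p b)"
    using carr ab by simp
  also have "\<dots> = commutator Q (?p ug) (?p wg)"
    using b_commute[OF conj(2)] carr ab by (intro p.H.commutator_mult_right) auto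
  also have "\<dots> = ?p (commutator F ug wg)"
    using carr by (simp add: p_commutator)
  finally have "inv\<^bsub>F\<^esub> (commutator F ug wg) \<otimes>\<^bsub>F\<^esub> commutator F uf wf \<in> B0_denominator {?v} F G \<pi>"
    using B0_class_eq_iff[OF pres] carr by (simp add: G.commutator_closed)
  then show ?case
    using f g by (simp add: defs word_eval_commutator[OF G.is_group _ words])
qed

section \<open>Lifts to the free groups\<close>

text \<open>
  The universal property of the free group: a basis element \<open>x\<close> is sent to some preimage under \<open>\<pi>'\<close>
  of \<open>\<alpha>(\<pi>(x))\<close>, and the two ways round the square agree because they agree on the basis.
\<close>

lemma lift_exists:
  assumes "free_presentation F G \<pi>" "free_presentation F' G' \<pi>'" "\<alpha> \<in> hom G G'"
  shows "\<exists>\<beta>. is_lift F \<pi> F' \<pi>' \<alpha> \<beta>"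
proof -
  interpret \<pi>: group_hom F G \<pi> using free_presentation_group_hom[OF assms(1)] .
  interpret \<pi>': group_hom F' G' \<pi>' using free_presentation_group_hom[OF assms(2)] .
  obtain X where X: "X \<subseteq> carrier F" and e: "word_eval F (\<lambda>x. x) \<in> iso (free_group X) F"
    using assms(1) by (auto simp: free_presentation_def is_free_group_def free_basis_def)
  let ?e = "word_eval F (\<lambda>x. x)" and ?W = "carrier (free_group X)"
  \<comment> \<open>Evaluation lemmas need an assignment of all letters to elements of the group; letters
    outside the basis do not occur in the words concerned and are sent to \<open>1\<close>.\<close>
  define g where "g x = (if x \<in> X then x else \<one>\<^bsub>F\<^esub>)" for x
  have g: "g x \<in> carrier F" for x using X by (auto simp: g_def)
  have \<alpha>\<pi>: "\<alpha> \<circ> \<pi> \<in> hom F G'" using hom_compose[OF \<pi>.homh assms(3)] .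
  have "\<exists>y. y \<in> carrier F' \<and> \<pi>' y = (\<alpha> \<circ> \<pi>) (g x)" for x
  proof -
    have "(\<alpha> \<circ> \<pi>) (g x) \<in> \<pi>' ` carrier F'"
      using hom_in_carrier[OF \<alpha>\<pi> g[of x]] assms(2) by (simp add: free_presentation_def epi_def)
    then show ?thesis by auto
  qed
  then obtain b where b: "\<And>x. b x \<in> carrier F'" "\<And>x. \<pi>' (b x) = (\<alpha> \<circ> \<pi>) (g x)"
    by metis
  have square: "\<pi>' (word_eval F' b w) = \<alpha> (\<pi> (?e w))" if "w \<in> ?W" for w
  proof -
    have "?e w = word_eval F g w"
      using that by (intro word_eval_cong) (auto simp: g_def free_group_def)
    then have "\<alpha> (\<pi> (?e w)) = word_eval G' (\<lambda>x. (\<alpha> \<circ> \<pi>) (g x)) w"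
      using word_eval_hom[where g = g and w = w, OF \<pi>.G.is_group \<pi>'.H.is_group \<alpha>\<pi> g] by simp
    also have "\<dots> = \<pi>' (word_eval F' b w)"
      using word_eval_hom[where g = b and w = w, OF \<pi>'.G.is_group \<pi>'.H.is_group \<pi>'.homh b(1)] b(2) by simp
    finally show ?thesis by simp
  qed
  let ?i = "inv_into ?W ?e"
  have i: "?i \<in> hom F (free_group X)"
    using group.iso_set_sym[OF group_free_group e] by (simp add: iso_def)
  have "word_eval F' b \<circ> ?i \<in> hom F F'"
    using hom_compose[OF i word_eval_hom_free_group[OF \<pi>'.G.is_group b(1)]] .
  moreover have "\<alpha> (\<pi> x) = \<pi>' ((word_eval F' b \<circ> ?i) x)" if "x \<in> carrier F" for x
  proof -
    have "x \<in> ?e ` ?W" using e that by (simp add: iso_def bij_betw_def)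
    then have "?i x \<in> ?W" "?e (?i x) = x" by (rule inv_into_into, rule f_inv_into_f)
    then show ?thesis using square[of "?i x"] by simp
  qed
  ultimately show ?thesis unfolding is_lift_def by blast
qed

lemma is_lift_id: "\<pi> \<in> hom F G \<Longrightarrow> is_lift F \<pi> F \<pi> id id"
  by (simp add: is_lift_def hom_def Pi_def)

lemma is_lift_comp:
  "is_lift F \<pi> F' \<pi>' \<alpha> \<beta> \<Longrightarrow> is_lift F' \<pi>' F'' \<pi>'' \<gamma> \<beta>' \<Longrightarrow> is_lift F \<pi> F'' \<pi>'' (\<gamma> \<circ> \<alpha>) (\<beta>' \<circ> \<beta>)"
  using hom_in_carrier by (fastforce simp: is_lift_def intro: hom_compose)

text \<open>A lift respects all that enters the definition of the invariant: word values, kernels, and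
  hence the subgroups forming numerator and denominator.\<close>

locale presentation_lift =
  fixes V :: "nat free_word set"
    and F :: "('a, 'm) monoid_scheme" and G :: "('b, 'n) monoid_scheme" and \<pi> :: "'a \<Rightarrow> 'b"
    and F' :: "('c, 'k) monoid_scheme" and G' :: "('d, 'l) monoid_scheme" and \<pi>' :: "'c \<Rightarrow> 'd"
    and \<alpha> :: "'b \<Rightarrow> 'd" and \<beta> :: "'a \<Rightarrow> 'c"
  assumes pres: "free_presentation F G \<pi>"
    and pres': "free_presentation F' G' \<pi>'"
    and alpha_hom: "\<alpha> \<in> hom G G'"
    and lift: "is_lift F \<pi> F' \<pi>' \<alpha> \<beta>"
begin

sublocale \<pi>: group_hom F G \<pi> by (rule free_presentation_group_hom[OF pres])
sublocale \<pi>': group_hom F' G' \<pi>' by (rule free_presentation_group_hom[OF pres'])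
sublocale \<alpha>: group_hom G G' \<alpha>
  using alpha_hom by unfold_locales
sublocale \<beta>: group_hom F F' \<beta>
  using lift by unfold_locales (simp add: is_lift_def)

lemma lift_word_values: "x \<in> word_values V F \<Longrightarrow> \<beta> x \<in> word_values V F'"
  using hom_word_values[OF \<pi>.G.is_group \<pi>'.G.is_group \<beta>.homh] .

lemma lift_kernel: "x \<in> kernel F G \<pi> \<Longrightarrow> \<beta> x \<in> kernel F' G' \<pi>'"
  using lift by (auto simp: kernel_def is_lift_def simp flip: \<alpha>.hom_one)

lemma lift_generate:
  assumes "S \<subseteq> carrier F" "\<beta> ` S \<subseteq> S'" "x \<in> generate F S"
  shows "\<beta> x \<in> generate F' S'"
  using \<beta>.generate_img[OF assms(1)] assms(3) \<pi>'.G.mono_generate[OF assms(2)] by blast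

lemma lift_denominator:
  "x \<in> B0_denominator V F G \<pi> \<Longrightarrow> \<beta> x \<in> B0_denominator V F' G' \<pi>'"
  unfolding B0_denominator_def
  by (rule lift_generate) (auto simp: lift_word_values lift_kernel, simp add: kernel_def)

lemma lift_numerator:
  "x \<in> B0_numerator V F G \<pi> \<Longrightarrow> \<beta> x \<in> B0_numerator V F' G' \<pi>'"
  unfolding B0_numerator_def verbal_subgroup_def
  using lift_generate[OF word_values_closed[OF \<pi>.G.is_group]] lift_word_values lift_kernel by blast

lemma lift_class_cong:
  assumes "x \<in> carrier F" "y \<in> carrier F" "B0_class V F G \<pi> x = B0_class V F G \<pi> y"
  shows "B0_class V F' G' \<pi>' (\<beta> x) = B0_class V F' G' \<pi>' (\<beta> y)"
  using assms lift_denominator[of "inv\<^bsub>F\<^esub> y \<otimes>\<^bsub>F\<^esub> x"]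
  by (simp add: B0_class_eq_iff[OF pres] B0_class_eq_iff[OF pres'])

end

text \<open>
  Two lifts agree modulo \<open>R'\<close>. On a word value they therefore take the values of one word at
  congruent tuples, which have the same class by \<open>outer_commutator_congruent\<close>; both composites with the
  class map are homomorphisms, so they agree on the subgroup generated by the word values.
\<close>

lemma lift_class_unique:
  assumes V: "V \<subseteq> outer_commutator_words"
    and pres: "free_presentation F G \<pi>" and pres': "free_presentation F' G' \<pi>'"
    and \<beta>: "is_lift F \<pi> F' \<pi>' \<alpha> \<beta>" and \<beta>': "is_lift F \<pi> F' \<pi>' \<alpha> \<beta>'"
    and x: "x \<in> verbal_subgroup V F"
  shows "B0_class V F' G' \<pi>' (\<beta> x) = B0_class V F' G' \<pi>' (\<beta>' x)"
proof -
  let ?p = "B0_class V F' G' \<pi>'"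
  define Q where "Q = F' Mod B0_denominator V F' G' \<pi>'"
  interpret \<pi>: group_hom F G \<pi> using free_presentation_group_hom[OF pres] .
  interpret p: group_hom F' Q ?p unfolding Q_def by (rule B0_class_hom[OF pres'])
  interpret \<beta>: group_hom F F' \<beta>
    using \<beta> by unfold_locales (simp add: is_lift_def)
  interpret \<beta>': group_hom F F' \<beta>'
    using \<beta>' by unfold_locales (simp add: is_lift_def)
  have T: "word_values V F \<subseteq> carrier F" by (rule word_values_closed[OF \<pi>.G.is_group])
  have gen: "?p (\<beta> x) = ?p (\<beta>' x)" if "x \<in> word_values V F" for x
  proof -
    obtain v k where v: "v \<in> V" and k: "\<And>i. k i \<in> carrier F" and x: "x = word_eval F k v"
      using \<open>x \<in> word_values V F\<close> by (auto simp: word_values_def)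
    obtain s where s: "outer_commutator s v"
      using V v by (auto simp: outer_commutator_words_def)
    have "\<pi>' (\<beta> (k i)) = \<pi>' (\<beta>' (k i))" for i
      using \<beta> \<beta>' k[of i] by (simp add: is_lift_def)
    then have "inv\<^bsub>F'\<^esub> (\<beta>' x) \<otimes>\<^bsub>F'\<^esub> \<beta> x \<in> B0_denominator {v} F' G' \<pi>'"
      using outer_commutator_congruent[OF pres' _ _ _ s, of "\<lambda>i. \<beta> (k i)" "\<lambda>i. \<beta>' (k i)"] k
      by (simp add: x word_eval_hom[OF \<pi>.G.is_group p.G.is_group])
    then show ?thesis
      using B0_denominator_mono[OF p.G.is_group, of "{v}" V G' \<pi>'] v that T
      by (subst B0_class_eq_iff[OF pres']) auto
  qed
  show ?thesis
    using x unfolding verbal_subgroup_def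
  proof (induction rule: generate.induct)
    case (eng a b)
    then have "a \<in> carrier F" "b \<in> carrier F"
      using \<pi>.G.generate_in_carrier[OF T] by auto
    with eng show ?case by simp
  qed (use gen T in auto)
qed

section \<open>The induced homomorphism\<close>

lemma carrier_B0: "carrier (B0 V F G \<pi>) = B0_class V F G \<pi> ` B0_numerator V F G \<pi>"
  by (auto simp: B0_def FactGroup_def RCOSETS_def B0_class_def r_coset_def)

lemma B0_numerator_subset: "B0_numerator V F G \<pi> \<subseteq> carrier F"
  by (auto simp: B0_numerator_def kernel_def)

lemma mult_B0_class:
  assumes "free_presentation F G \<pi>" "x \<in> carrier F" "y \<in> carrier F"
  shows "B0_class V F G \<pi> x \<otimes>\<^bsub>B0 V F G \<pi>\<^esub> B0_class V F G \<pi> y = B0_class V F G \<pi> (x \<otimes>\<^bsub>F\<^esub> y)"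
  using normal.rcos_sum[OF B0_denominator_normal[OF assms(1)] assms(2,3), of V]
  by (simp add: B0_def FactGroup_def B0_class_def set_mult_def)

lemma B0_numerator_mult:
  assumes "free_presentation F G \<pi>" "x \<in> B0_numerator V F G \<pi>" "y \<in> B0_numerator V F G \<pi>"
  shows "x \<otimes>\<^bsub>F\<^esub> y \<in> B0_numerator V F G \<pi>"
proof -
  interpret group_hom F G \<pi> using free_presentation_group_hom[OF assms(1)] .
  show ?thesis using assms(2,3)
    by (auto simp: B0_numerator_def verbal_subgroup_def kernel_def intro: generate.eng)
qed

text \<open>
  The description defining \<open>B0_hom\<close> quantifies over all lifts. One lift \<open>\<beta>\<close> yields a map by
  applying \<open>\<beta>\<close> to a representative of each class; by \<open>lift_class_unique\<close> it serves for every other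
  lift as well. Uniqueness needs that a lift exists, since otherwise the condition on
  classes would be vacuous.
\<close>

lemma B0_hom_characterization:
  assumes V: "V \<subseteq> outer_commutator_words"
    and pres: "free_presentation F G \<pi>" and pres': "free_presentation F' G' \<pi>'"
    and \<alpha>: "\<alpha> \<in> hom G G'"
  shows B0_hom_extensional:
      "B0_hom V F G \<pi> F' G' \<pi>' \<alpha> \<in> extensional (carrier (B0 V F G \<pi>))" (is ?ext)
    and B0_hom_hom: "B0_hom V F G \<pi> F' G' \<pi>' \<alpha> \<in> hom (B0 V F G \<pi>) (B0 V F' G' \<pi>')" (is ?hom)
    and B0_hom_class: "\<And>\<beta> x. is_lift F \<pi> F' \<pi>' \<alpha> \<beta> \<Longrightarrow> x \<in> B0_numerator V F G \<pi> \<Longrightarrow>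
      B0_hom V F G \<pi> F' G' \<pi>' \<alpha> (B0_class V F G \<pi> x) = B0_class V F' G' \<pi>' (\<beta> x)"
proof -
  let ?N = "B0_numerator V F G \<pi>" and ?c = "B0_class V F G \<pi>" and ?c' = "B0_class V F' G' \<pi>'"
  define P where "P \<phi> \<longleftrightarrow> \<phi> \<in> extensional (carrier (B0 V F G \<pi>)) \<and>
    \<phi> \<in> hom (B0 V F G \<pi>) (B0 V F' G' \<pi>') \<and>
    (\<forall>\<beta>. is_lift F \<pi> F' \<pi>' \<alpha> \<beta> \<longrightarrow> (\<forall>x\<in>?N. \<phi> (?c x) = ?c' (\<beta> x)))" for \<phi>
  obtain \<beta> where \<beta>: "is_lift F \<pi> F' \<pi>' \<alpha> \<beta>" using lift_exists[OF pres pres' \<alpha>] by blast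
  interpret presentation_lift V F G \<pi> F' G' \<pi>' \<alpha> \<beta>
    using pres pres' \<alpha> \<beta> by unfold_locales
  note N = subsetD[OF B0_numerator_subset[of V F G \<pi>]]
  define \<phi> where "\<phi> = (\<lambda>C\<in>carrier (B0 V F G \<pi>). ?c' (\<beta> (inv_into ?N ?c C)))"
  have \<phi>: "\<phi> (?c x) = ?c' (\<beta> x)" if "x \<in> ?N" for x
  proof -
    have "?c (inv_into ?N ?c (?c x)) = ?c x" "inv_into ?N ?c (?c x) \<in> ?N"
      using f_inv_into_f[of "?c x" ?c ?N] inv_into_into[of "?c x" ?c ?N] that by simp_all
    then show ?thesis
      using that lift_class_cong[OF N N, of "inv_into ?N ?c (?c x)" x]
      by (simp add: \<phi>_def carrier_B0)
  qed
  have "P \<phi>"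
    unfolding P_def
  proof (intro conjI allI impI ballI)
    show "\<phi> \<in> extensional (carrier (B0 V F G \<pi>))" by (simp add: \<phi>_def)
    show "\<phi> \<in> hom (B0 V F G \<pi>) (B0 V F' G' \<pi>')"
    proof (rule homI)
      fix C D assume "C \<in> carrier (B0 V F G \<pi>)" "D \<in> carrier (B0 V F G \<pi>)"
      then obtain x y where "x \<in> ?N" "y \<in> ?N" "C = ?c x" "D = ?c y"
        by (auto simp: carrier_B0)
      then show "\<phi> (C \<otimes>\<^bsub>B0 V F G \<pi>\<^esub> D) = \<phi> C \<otimes>\<^bsub>B0 V F' G' \<pi>'\<^esub> \<phi> D"
        by (simp add: mult_B0_class[OF pres] mult_B0_class[OF pres'] \<phi>
            B0_numerator_mult[OF pres] N)
    qed (auto simp: carrier_B0 \<phi> lift_numerator)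
  next
    fix \<beta>' x assume "is_lift F \<pi> F' \<pi>' \<alpha> \<beta>'" "x \<in> ?N"
    then show "\<phi> (?c x) = ?c' (\<beta>' x)"
      using lift_class_unique[OF V pres pres' \<beta>, of \<beta>' x] \<phi> by (simp add: B0_numerator_def)
  qed
  moreover have "\<psi> = \<phi>" if "P \<psi>" for \<psi>
  proof (rule extensionalityI)
    show "\<psi> C = \<phi> C" if "C \<in> carrier (B0 V F G \<pi>)" for C
      using that \<open>P \<psi>\<close> \<open>P \<phi>\<close> \<beta> unfolding P_def carrier_B0 by auto
  qed (use that \<open>P \<phi>\<close> in \<open>auto simp: P_def\<close>)
  ultimately have "P (THE \<phi>. P \<phi>)" by (rule theI)
  then have "P (B0_hom V F G \<pi> F' G' \<pi>' \<alpha>)" by (simp add: P_def B0_hom_def)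
  then show ?ext ?hom
    "\<And>\<beta> x. is_lift F \<pi> F' \<pi>' \<alpha> \<beta> \<Longrightarrow> x \<in> ?N \<Longrightarrow>
      B0_hom V F G \<pi> F' G' \<pi>' \<alpha> (?c x) = ?c' (\<beta> x)"
    by (auto simp: P_def)
qed

text \<open>The composite of a lift of \<open>\<alpha>\<close> and a lift of \<open>\<gamma>\<close> is a lift of \<open>\<gamma> \<circ> \<alpha>\<close>, and any lift may be used
  to compute the induced map.\<close>

lemma B0_hom_comp:
  assumes V: "V \<subseteq> outer_commutator_words"
    and pres: "free_presentation F G \<pi>" and pres': "free_presentation F' G' \<pi>'"
    and pres'': "free_presentation F'' G'' \<pi>''"
    and \<alpha>: "\<alpha> \<in> hom G G'" and \<gamma>: "\<gamma> \<in> hom G' G''"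
  shows "B0_hom V F G \<pi> F'' G'' \<pi>'' (\<gamma> \<circ> \<alpha>) =
    compose (carrier (B0 V F G \<pi>))
      (B0_hom V F' G' \<pi>' F'' G'' \<pi>'' \<gamma>) (B0_hom V F G \<pi> F' G' \<pi>' \<alpha>)"
proof (rule extensionalityI)
  have \<gamma>\<alpha>: "\<gamma> \<circ> \<alpha> \<in> hom G G''" using hom_compose[OF \<alpha> \<gamma>] .
  show "B0_hom V F G \<pi> F'' G'' \<pi>'' (\<gamma> \<circ> \<alpha>) \<in> extensional (carrier (B0 V F G \<pi>))"
    by (rule B0_hom_extensional[OF V pres pres'' \<gamma>\<alpha>])
  fix C assume "C \<in> carrier (B0 V F G \<pi>)"
  then obtain x where x: "x \<in> B0_numerator V F G \<pi>" and C: "C = B0_class V F G \<pi> x"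
    by (auto simp: carrier_B0)
  obtain \<beta> \<beta>' where \<beta>: "is_lift F \<pi> F' \<pi>' \<alpha> \<beta>" and \<beta>': "is_lift F' \<pi>' F'' \<pi>'' \<gamma> \<beta>'"
    using lift_exists[OF pres pres' \<alpha>] lift_exists[OF pres' pres'' \<gamma>] by blast
  interpret presentation_lift V F G \<pi> F' G' \<pi>' \<alpha> \<beta>
    using pres pres' \<alpha> \<beta> by unfold_locales
  show "B0_hom V F G \<pi> F'' G'' \<pi>'' (\<gamma> \<circ> \<alpha>) C = compose (carrier (B0 V F G \<pi>))
      (B0_hom V F' G' \<pi>' F'' G'' \<pi>'' \<gamma>) (B0_hom V F G \<pi> F' G' \<pi>' \<alpha>) C"
    using x lift_numerator[OF x] B0_hom_class[OF V pres pres' \<alpha> \<beta> x]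
      B0_hom_class[OF V pres' pres'' \<gamma> \<beta>'] B0_hom_class[OF V pres pres'' \<gamma>\<alpha> is_lift_comp[OF \<beta> \<beta>'] x]
    by (simp add: C compose_def carrier_B0)
qed simp

lemma B0_hom_id:
  assumes "V \<subseteq> outer_commutator_words" and pres: "free_presentation F G \<pi>"
    and "C \<in> carrier (B0 V F G \<pi>)"
  shows "B0_hom V F G \<pi> F G \<pi> id C = C"
proof -
  interpret group_hom F G \<pi> using free_presentation_group_hom[OF pres] .
  have "id \<in> hom G G" by (simp add: hom_def Pi_def)
  with assms show ?thesis
    using B0_hom_class[OF assms(1) pres pres _ is_lift_id[OF homh]] by (auto simp: carrier_B0)
qed

text \<open>The maps induced by the identity of \<open>G\<close> in the two directions are inverse to each other by
  functoriality.\<close>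

lemma B0_iso:
  assumes V: "V \<subseteq> outer_commutator_words"
    and pres: "free_presentation F G \<pi>" and pres': "free_presentation E G \<rho>"
  shows "B0 V F G \<pi> \<cong> B0 V E G \<rho>"
proof -
  let ?A = "B0 V F G \<pi>" and ?B = "B0 V E G \<rho>"
  let ?f = "B0_hom V F G \<pi> E G \<rho> id" and ?g = "B0_hom V E G \<rho> F G \<pi> id"
  have id: "id \<in> hom G G" by (simp add: hom_def Pi_def)
  have f: "?f \<in> hom ?A ?B" and g: "?g \<in> hom ?B ?A"
    using B0_hom_hom[OF V pres pres' id] B0_hom_hom[OF V pres' pres id] .
  have "?g (?f C) = C" if "C \<in> carrier ?A" for C
    using B0_hom_comp[OF V pres pres' pres id id] B0_hom_id[OF V pres that] that
    by (metis comp_id compose_eq)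
  moreover have "?f (?g D) = D" if "D \<in> carrier ?B" for D
    using B0_hom_comp[OF V pres' pres pres' id id] B0_hom_id[OF V pres' that] that
    by (metis comp_id compose_eq)
  ultimately have "bij_betw ?f (carrier ?A) (carrier ?B)"
    using hom_in_carrier[OF f] hom_in_carrier[OF g]
    by (intro bij_betw_byWitness[where f' = ?g]) auto
  with f show ?thesis by (auto simp: is_iso_def iso_def)
qed


theorem lemma3p2:
  fixes V :: "nat free_word set"
    and F :: "('a, 'm) monoid_scheme" and G :: "('b, 'n) monoid_scheme" and \<pi> :: "'a \<Rightarrow> 'b"
    and F' :: "('c, 'k) monoid_scheme" and G' :: "('d, 'l) monoid_scheme" and \<pi>' :: "'c \<Rightarrow> 'd"
    and \<alpha> :: "'b \<Rightarrow> 'd"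
  assumes V: "V \<subseteq> outer_commutator_words"
    and pres: "free_presentation F G \<pi>"
    and pres': "free_presentation F' G' \<pi>'"
    and \<alpha>: "\<alpha> \<in> hom G G'"
  shows
    "(\<exists>\<beta>. is_lift F \<pi> F' \<pi>' \<alpha> \<beta>) \<and>
     ((\<forall>\<beta>. is_lift F \<pi> F' \<pi>' \<alpha> \<beta> \<longrightarrow>
        (\<forall>x\<in>B0_numerator V F G \<pi>. \<beta> x \<in> B0_numerator V F' G' \<pi>') \<and>
        (\<forall>x\<in>B0_numerator V F G \<pi>. \<forall>y\<in>B0_numerator V F G \<pi>.
          B0_class V F G \<pi> x = B0_class V F G \<pi> y \<longrightarrow>
          B0_class V F' G' \<pi>' (\<beta> x) = B0_class V F' G' \<pi>' (\<beta> y))) \<and>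
      B0_hom V F G \<pi> F' G' \<pi>' \<alpha> \<in> hom (B0 V F G \<pi>) (B0 V F' G' \<pi>') \<and>
      (\<forall>\<beta>. is_lift F \<pi> F' \<pi>' \<alpha> \<beta> \<longrightarrow>
        (\<forall>x\<in>B0_numerator V F G \<pi>.
          B0_hom V F G \<pi> F' G' \<pi>' \<alpha> (B0_class V F G \<pi> x) = B0_class V F' G' \<pi>' (\<beta> x)))) \<and>
     (\<forall>(F'' :: ('e, 'p) monoid_scheme) (G'' :: ('f, 'q) monoid_scheme) \<pi>'' \<gamma>.
      free_presentation F'' G'' \<pi>'' \<and> \<gamma> \<in> hom G' G'' \<longrightarrow>
      B0_hom V F G \<pi> F'' G'' \<pi>'' (\<gamma> \<circ> \<alpha>) =
        compose (carrier (B0 V F G \<pi>))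
          (B0_hom V F' G' \<pi>' F'' G'' \<pi>'' \<gamma>) (B0_hom V F G \<pi> F' G' \<pi>' \<alpha>)) \<and>
     (\<forall>(E :: ('g, 'r) monoid_scheme) \<rho>.
      free_presentation E G \<rho> \<longrightarrow> B0 V F G \<pi> \<cong> B0 V E G \<rho>)"
proof (intro conjI allI impI ballI)
  show "\<exists>\<beta>. is_lift F \<pi> F' \<pi>' \<alpha> \<beta>"
    by (rule lift_exists[OF pres pres' \<alpha>])
next
  fix \<beta> x assume "is_lift F \<pi> F' \<pi>' \<alpha> \<beta>" "x \<in> B0_numerator V F G \<pi>"
  then show "\<beta> x \<in> B0_numerator V F' G' \<pi>'"
    using presentation_lift.lift_numerator[OF presentation_lift.intro[OF pres pres' \<alpha>]] by blast
next
  fix \<beta> x y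
  assume "is_lift F \<pi> F' \<pi>' \<alpha> \<beta>" "x \<in> B0_numerator V F G \<pi>" "y \<in> B0_numerator V F G \<pi>"
    and "B0_class V F G \<pi> x = B0_class V F G \<pi> y"
  then show "B0_class V F' G' \<pi>' (\<beta> x) = B0_class V F' G' \<pi>' (\<beta> y)"
    using presentation_lift.lift_class_cong[OF presentation_lift.intro[OF pres pres' \<alpha>]]
      subsetD[OF B0_numerator_subset[of V F G \<pi>]] by simp
next
  show "B0_hom V F G \<pi> F' G' \<pi>' \<alpha> \<in> hom (B0 V F G \<pi>) (B0 V F' G' \<pi>')"
    by (rule B0_hom_hom[OF V pres pres' \<alpha>])
next
  fix \<beta> x assume "is_lift F \<pi> F' \<pi>' \<alpha> \<beta>" "x \<in> B0_numerator V F G \<pi>"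
  then show "B0_hom V F G \<pi> F' G' \<pi>' \<alpha> (B0_class V F G \<pi> x) = B0_class V F' G' \<pi>' (\<beta> x)"
    by (rule B0_hom_class[OF V pres pres' \<alpha>])
next
  fix F'' :: "('e, 'p) monoid_scheme" and G'' :: "('f, 'q) monoid_scheme" and \<pi>'' \<gamma>
  assume "free_presentation F'' G'' \<pi>'' \<and> \<gamma> \<in> hom G' G''"
  then show "B0_hom V F G \<pi> F'' G'' \<pi>'' (\<gamma> \<circ> \<alpha>) =
      compose (carrier (B0 V F G \<pi>))
        (B0_hom V F' G' \<pi>' F'' G'' \<pi>'' \<gamma>) (B0_hom V F G \<pi> F' G' \<pi>' \<alpha>)"
    using B0_hom_comp[OF V pres pres' _ \<alpha>] by blast
next
  fix E :: "('g, 'r) monoid_scheme" and \<rho>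
  assume "free_presentation E G \<rho>"
  then show "B0 V F G \<pi> \<cong> B0 V E G \<rho>"
    by (rule B0_iso[OF V pres])
qed

end
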